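(* For every $n\ge 2$, the tropicalization of the Pollaczek-Geiringer variety $\mathrm{CM}_n^2$ is the Minkowski sum of two copies of the set of ultrametrics on $[n]$: $$\mathrm{trop}(\mathrm{CM}_n^2)=U_n+U_n=\{\delta+\delta' : \delta,\delta'\in U_n\}\subseteq \mathbb{R}^{\binom{[n]}{2}}.$$
   Context: Coordinates of $\mathbb{C}^{\binom{[n]}{2}}$ and $\mathbb{R}^{\binom{[n]}{2}}$ are indexed by unordered pairs $uv$ with $u<v$ in $[n]=\{1,\dots,n\}$. The Cayley-Menger variety $\mathrm{CM}_n^d\subseteq\mathbb{C}^{\binom{[n]}{2}}$ is the Zariski closure of the set of vectors $(\|p_u-p_v\|^2)_{u<v}$ where $p_1,\dots,p_n$ range over $\mathbb{R}^d$; for $d=2$ it is called the Pollaczek-Geiringer variety. Tropicalization uses the max convention: let $K=\mathbb{C}\{\!\{t\}\!\}$ be the field of complex Puiseux series with valuation $\mathrm{val}(a)=-(\text{smallest exponent of } t \text{ occurring in } a)$ and $\mathrm{val}(0)=-\infty$. For a variety $X\subseteq\mathbb{C}^S$ with ideal $I$, let $X'\subseteq K^S$ be the vanishing set of $I\cdot K[x_i:i\in S]$; then $\mathrm{trop}(X)$ is the Euclidean closure of $\{(\mathrm{val}(x_i))_{i\in S}: x\in X'\}\cap\mathbb{R}^S$. A vector $\delta\in\mathbb{R}^{\binom{[n]}{2}}$ is an ultrametric if $\delta_{uv}\le\max\{\delta_{uw},\delta_{vw}\}$ for all triples of distinct $u,v,w\in[n]$ (no nonnegativity is required); $U_n$ denotes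 the set of all ultrametrics in $\mathbb{R}^{\binom{[n]}{2}}$. *)

theory Defs
  imports "HOL-Analysis.Analysis" "HOL-Library.Poly_Mapping"
    "HOL-Computational_Algebra.Formal_Laurent_Series"
begin

definition pairs :: "nat \<Rightarrow> (nat \<times> nat) set" where
  "pairs n = {(u, v). 1 \<le> u \<and> u < v \<and> v \<le> n}"

text \<open>Polynomials with complex coefficients in variables indexed by nat x nat:
  finitely supported maps from monomials (finitely supported exponent vectors) to coefficients.\<close>
type_synonym mpoly = "((nat \<times> nat, nat) poly_mapping, complex) poly_mapping"

definition poly_in :: "(nat \<times> nat) set \<Rightarrow> mpoly \<Rightarrow> bool" where
  "poly_in S p \<longleftrightarrow> (\<forall>mon\<in>Poly_Mapping.keys p. Poly_Mapping.keys mon \<subseteq> S)"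

definition mpeval :: "(complex \<Rightarrow> 'a::comm_ring_1) \<Rightarrow> mpoly \<Rightarrow> (nat \<times> nat \<Rightarrow> 'a) \<Rightarrow> 'a" where
  "mpeval c p x = (\<Sum>m\<in>Poly_Mapping.keys p. c (Poly_Mapping.lookup p m) * (\<Prod>i\<in>Poly_Mapping.keys m. x i ^ Poly_Mapping.lookup m i))"

text \<open>Points of C^S are functions vanishing outside S.\<close>
definition vanishing_ideal :: "(nat \<times> nat) set \<Rightarrow> (nat \<times> nat \<Rightarrow> complex) set \<Rightarrow> mpoly set" where
  "vanishing_ideal S X = {p. poly_in S p \<and> (\<forall>x\<in>X. mpeval id p x = 0)}"

definition zero_set :: "(nat \<times> nat) set \<Rightarrow> mpoly set \<Rightarrow> (nat \<times> nat \<Rightarrow> complex) set" where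
  "zero_set S P = {x. (\<forall>i. i \<notin> S \<longrightarrow> x i = 0) \<and> (\<forall>p\<in>P. mpeval id p x = 0)}"

definition zariski_closure :: "(nat \<times> nat) set \<Rightarrow> (nat \<times> nat \<Rightarrow> complex) set \<Rightarrow> (nat \<times> nat \<Rightarrow> complex) set" where
  "zariski_closure S X = zero_set S (vanishing_ideal S X)"

definition CM :: "nat \<Rightarrow> nat \<Rightarrow> (nat \<times> nat \<Rightarrow> complex) set" where
  "CM n d = zariski_closure (pairs n)
     {x. \<exists>p :: nat \<Rightarrow> nat \<Rightarrow> real.
         x = (\<lambda>(u, v). if (u, v) \<in> pairs n
                        then complex_of_real (\<Sum>i<d. (p u i - p v i)^2) else 0)}"

text \<open>Tropicalization (max convention) over the complex Puiseux series field K.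
  A point of K^S (S finite) has a common denominator N, i.e. its coordinates are
  y_i(t^(1/N)) with y_i in C((s)) (formal Laurent series). Its valuation is
  -(smallest exponent) = -(subdegree y_i)/N. The K-points of V(I K[x]) are those at
  which all p in I vanish; intersecting with R^S means all coordinates nonzero.
  The Euclidean closure is taken in the product topology on nat x nat => real, on
  which vectors vanishing outside the finite set S form a copy of R^S.\<close>
definition trop :: "(nat \<times> nat) set \<Rightarrow> (nat \<times> nat \<Rightarrow> complex) set \<Rightarrow> (nat \<times> nat \<Rightarrow> real) set" where
  "trop S X = closure
     {\<delta>. \<exists>(N::nat) (y :: nat \<times> nat \<Rightarrow> complex fls). N > 0 \<and>
          (\<forall>i\<in>S. y i \<noteq> 0) \<and>
          (\<forall>p\<in>vanishing_ideal S X. mpeval fls_const p y = 0) \<and>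
          \<delta> = (\<lambda>i. if i \<in> S then - real_of_int (fls_subdegree (y i)) / real N else 0)}"

definition dist_pair :: "(nat \<times> nat \<Rightarrow> real) \<Rightarrow> nat \<Rightarrow> nat \<Rightarrow> real" where
  "dist_pair \<delta> u v = \<delta> (min u v, max u v)"

definition ultrametrics :: "nat \<Rightarrow> (nat \<times> nat \<Rightarrow> real) set" where
  "ultrametrics n = {\<delta>. (\<forall>i. i \<notin> pairs n \<longrightarrow> \<delta> i = 0) \<and>
     (\<forall>u\<in>{1..n}. \<forall>v\<in>{1..n}. \<forall>w\<in>{1..n}. u \<noteq> v \<and> u \<noteq> w \<and> v \<noteq> w \<longrightarrow>
        dist_pair \<delta> u v \<le> max (dist_pair \<delta> u w) (dist_pair \<delta> v w))}"

end

theory Submission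
  imports Defs "HOL-Computational_Algebra.Fundamental_Theorem_Algebra"
begin

unbundle fps_syntax
unbundle no vec_syntax

text \<open>Since \<open>x\<^sup>2 + z\<^sup>2 = (x + \<i>z)(x - \<i>z)\<close>, the variety is parametrized by
  \<open>y\<^sub>u\<^sub>v = (a\<^sub>u - a\<^sub>v)(b\<^sub>u - b\<^sub>v)\<close>, and \<open>(u, v) \<mapsto> val (a\<^sub>u - a\<^sub>v)\<close> is an ultrametric.
  The parametrization is surjective over an algebraically closed field, because a symmetric matrix
  of rank at most 2 is the Gram matrix of planar points; a single square root suffices for this, so
  over Laurent series in \<open>s\<close> it is enough to substitute \<open>s\<^sup>2\<close> for \<open>s\<close>. Hence the valuation
  of every point is a sum of two ultrametrics, and the set of such sums is closed.

  Conversely, every integral ultrametric is \<open>val (a\<^sub>u - a\<^sub>v)\<close> for Laurent series \<open>a\<^sub>u\<close> whose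
  coefficient of \<open>s\<^sup>k\<close> labels the ball of radius \<open>- k\<close> around \<open>u\<close>, and rounding is monotone,
  so that rational ultrametrics are dense. A polynomial vanishing on all real planar configurations
  vanishes on all Laurent series configurations: replace the real coordinates by Laurent series one
  at a time.\<close>

section \<open>Evaluation of polynomials\<close>

locale comm_ring_hom =
  fixes h :: "'a::comm_ring_1 \<Rightarrow> 'b::comm_ring_1"
  assumes hom_add: "h (a + b) = h a + h b"
    and hom_mult: "h (a * b) = h a * h b"
    and hom_one: "h 1 = 1"
begin

lemma hom_zero: "h 0 = 0"
  using hom_add[of 0 0] by simp

lemma hom_diff: "h (a - b) = h a - h b"
  using hom_add[of "a - b" b] by (simp add: algebra_simps)

lemma hom_power: "h (a ^ k) = h a ^ k"
  by (induction k) (simp_all add: hom_one hom_mult)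

lemma hom_sum: "h (sum f T) = (\<Sum>k\<in>T. h (f k))"
  by (induction T rule: infinite_finite_induct) (simp_all add: hom_zero hom_add)

lemma hom_prod: "h (prod f T) = (\<Prod>k\<in>T. h (f k))"
  by (induction T rule: infinite_finite_induct) (simp_all add: hom_one hom_mult)

lemma hom_mpeval: "h (mpeval c p x) = mpeval (\<lambda>a. h (c a)) p (\<lambda>i. h (x i))"
  by (simp add: mpeval_def hom_sum hom_prod hom_mult hom_power)

end

definition monomial_eval :: "('i \<Rightarrow> 'a::comm_ring_1) \<Rightarrow> ('i, nat) poly_mapping \<Rightarrow> 'a" where
  "monomial_eval x m = (\<Prod>i\<in>Poly_Mapping.keys m. x i ^ Poly_Mapping.lookup m i)"

lemma monomial_eval_superset:
  assumes "finite T" "Poly_Mapping.keys m \<subseteq> T"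
  shows "monomial_eval x m = (\<Prod>i\<in>T. x i ^ Poly_Mapping.lookup m i)"
  unfolding monomial_eval_def
  by (rule prod.mono_neutral_left) (use assms in \<open>auto simp: in_keys_iff\<close>)

lemma monomial_eval_add: "monomial_eval x (m + m') = monomial_eval x m * monomial_eval x m'"
proof -
  let ?T = "Poly_Mapping.keys m \<union> Poly_Mapping.keys m'"
  have "monomial_eval x k = (\<Prod>i\<in>?T. x i ^ Poly_Mapping.lookup k i)"
    if "Poly_Mapping.keys k \<subseteq> ?T" for k
    using that by (intro monomial_eval_superset) auto
  then show ?thesis
    using keys_add[of m m'] by (simp add: lookup_add power_add prod.distrib)
qed

lemma mpeval_conv_monomial_eval:
  "mpeval c p x = (\<Sum>m\<in>Poly_Mapping.keys p. c (Poly_Mapping.lookup p m) * monomial_eval x m)"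
  by (simp add: mpeval_def monomial_eval_def)

lemma mpeval_cong:
  assumes "poly_in S p" "\<And>i. i \<in> S \<Longrightarrow> x i = y i"
  shows "mpeval c p x = mpeval c p y"
  using assms unfolding mpeval_def poly_in_def
  by (intro sum.cong arg_cong2[where f = "(*)"] prod.cong) (auto simp: subset_iff)

lemma poly_mapping_sum_single:
  "(\<Sum>m\<in>Poly_Mapping.keys p. Poly_Mapping.single m (Poly_Mapping.lookup p m)) = p"
  by (rule poly_mapping_eqI) (auto simp: lookup_sum lookup_single when_def in_keys_iff)

definition const_mpoly :: "complex \<Rightarrow> mpoly" where
  "const_mpoly a = Poly_Mapping.single 0 a"

definition var_mpoly :: "nat \<times> nat \<Rightarrow> mpoly" where
  "var_mpoly i = Poly_Mapping.single (Poly_Mapping.single i 1) 1"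

locale coeff_hom = comm_ring_hom c for c :: "complex \<Rightarrow> 'a::comm_ring_1"
begin

lemma mpeval_superset:
  assumes "finite T" "Poly_Mapping.keys p \<subseteq> T"
  shows "mpeval c p x = (\<Sum>m\<in>T. c (Poly_Mapping.lookup p m) * monomial_eval x m)"
  unfolding mpeval_conv_monomial_eval
  by (rule sum.mono_neutral_left) (use assms in \<open>auto simp: in_keys_iff hom_zero\<close>)

lemma mpeval_single: "mpeval c (Poly_Mapping.single m a) x = c a * monomial_eval x m"
  by (simp add: mpeval_superset[of "{m}"])

lemma mpeval_const: "mpeval c (const_mpoly a) x = c a"
  by (simp add: const_mpoly_def mpeval_single monomial_eval_def)

lemma mpeval_var: "mpeval c (var_mpoly i) x = x i"
  by (simp add: var_mpoly_def mpeval_single monomial_eval_def hom_one)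

lemma mpeval_add: "mpeval c (p + q) x = mpeval c p x + mpeval c q x"
proof -
  let ?T = "Poly_Mapping.keys p \<union> Poly_Mapping.keys q"
  have "mpeval c r x = (\<Sum>m\<in>?T. c (Poly_Mapping.lookup r m) * monomial_eval x m)"
    if "Poly_Mapping.keys r \<subseteq> ?T" for r
    using that by (intro mpeval_superset) auto
  then show ?thesis
    using keys_add[of p q] by (simp add: lookup_add hom_add distrib_right sum.distrib)
qed

lemma mpeval_sum: "mpeval c (\<Sum>k\<in>T. f k) x = (\<Sum>k\<in>T. mpeval c (f k) x)"
  by (induction T rule: infinite_finite_induct) (simp_all add: mpeval_add, simp_all add: mpeval_def)

lemma mpeval_mult: "mpeval c (p * q) x = mpeval c p x * mpeval c q x"
proof -
  let ?s = "\<lambda>p m. Poly_Mapping.single m (Poly_Mapping.lookup p m)"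
  have "mpeval c (p * q) x =
      mpeval c ((\<Sum>m\<in>Poly_Mapping.keys p. ?s p m) * (\<Sum>m\<in>Poly_Mapping.keys q. ?s q m)) x"
    by (simp only: poly_mapping_sum_single)
  also have "\<dots> = (\<Sum>m\<in>Poly_Mapping.keys p. c (Poly_Mapping.lookup p m) * monomial_eval x m) *
      (\<Sum>m\<in>Poly_Mapping.keys q. c (Poly_Mapping.lookup q m) * monomial_eval x m)"
    by (simp add: sum_product mpeval_sum mult_single mpeval_single hom_mult monomial_eval_add
        mult_ac)
  also have "\<dots> = mpeval c p x * mpeval c q x"
    by (simp only: mpeval_conv_monomial_eval)
  finally show ?thesis .
qed

sublocale mpeval: comm_ring_hom "\<lambda>p. mpeval c p x" for x
proof
  show "mpeval c 1 x = 1"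
    using mpeval_const[of 1] by (simp add: const_mpoly_def hom_one)
qed (fact mpeval_add mpeval_mult)+

lemma mpeval_subst: "mpeval c (mpeval const_mpoly p g) x = mpeval c p (\<lambda>i. mpeval c (g i) x)"
  by (simp add: mpeval.hom_mpeval mpeval_const)

lemma mpeval_fun_upd_eq_poly: "\<exists>q. \<forall>t. mpeval c p (x(i := t)) = poly q t"
proof (intro exI allI)
  fix t :: 'a
  let ?y = "\<lambda>j. if j = i then [:0, 1:] else [:x j:]"
  interpret poly_at: comm_ring_hom "\<lambda>q. poly q t"
    by unfold_locales auto
  have "(\<lambda>j. poly (?y j) t) = x(i := t)"
    by auto
  then show "mpeval c p (x(i := t)) = poly (mpeval (\<lambda>a. [:c a:]) p ?y) t"
    by (simp add: poly_at.hom_mpeval)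
qed

end

interpretation id_hom: coeff_hom "id :: complex \<Rightarrow> complex"
  by unfold_locales auto

interpretation fls_const_hom: coeff_hom fls_const
  by unfold_locales (auto simp: fls_plus_const)

lemma coordinatewise_polynomial_eq_0:
  fixes F :: "('b \<Rightarrow> 'a::idom) \<Rightarrow> 'a"
  assumes "finite B" "infinite C"
    and poly: "\<And>x i. \<exists>q. \<forall>t. F (x(i := t)) = poly q t"
    and zero: "\<And>x. range x \<subseteq> C \<Longrightarrow> F x = 0"
    and "x ` (- B) \<subseteq> C"
  shows "F x = 0"
  using assms(1,5)
proof (induction B arbitrary: x rule: finite_induct)
  case empty
  then show ?case using zero by simp
next
  case (insert j B)
  obtain q where q: "\<And>t. F (x(j := t)) = poly q t"
    using poly by blast
  have "poly q t = 0" if "t \<in> C" for t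
    unfolding q[symmetric] by (rule insert.IH) (use insert.prems that in auto)
  then have "C \<subseteq> {t. poly q t = 0}"
    by blast
  then have "q = 0"
    using assms(2) poly_roots_finite finite_subset by blast
  then show ?case
    using q[of "x j"] by simp
qed

lemma mpeval_eq_0_if_zero_on_infinite_grid:
  fixes c :: "complex \<Rightarrow> 'a::idom"
  assumes "coeff_hom c" "infinite C"
    and zero: "\<And>x. range x \<subseteq> C \<Longrightarrow> mpeval c p x = 0"
  shows "mpeval c p x = 0"
proof -
  interpret coeff_hom c by fact
  define B where "B = (\<Union>m\<in>Poly_Mapping.keys p. Poly_Mapping.keys m)"
  obtain s where "s \<in> C"
    using infinite_imp_nonempty[OF \<open>infinite C\<close>] by blast
  define y where "y i = (if i \<in> B then x i else s)" for i
  have "mpeval c p x = mpeval c p y"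
    by (rule mpeval_cong[of B]) (auto simp: poly_in_def B_def y_def)
  also have "\<dots> = 0"
  proof (rule coordinatewise_polynomial_eq_0[where F = "mpeval c p" and B = B and C = C])
    show "finite B" by (simp add: B_def)
    show "y ` (- B) \<subseteq> C" using \<open>s \<in> C\<close> by (auto simp: y_def)
  qed (use \<open>infinite C\<close> mpeval_fun_upd_eq_poly zero in blast)+
  finally show ?thesis .
qed

lemma poly_in_zero: "poly_in S 0"
  by (simp add: poly_in_def)

lemma poly_in_var: "i \<in> S \<Longrightarrow> poly_in S (var_mpoly i)"
  by (simp add: poly_in_def var_mpoly_def)

lemma poly_in_add: "poly_in S p \<Longrightarrow> poly_in S q \<Longrightarrow> poly_in S (p + q)"
  unfolding poly_in_def using keys_add[of p q] by blast

lemma poly_in_diff: "poly_in S p \<Longrightarrow> poly_in S q \<Longrightarrow> poly_in S (p - q)"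
  unfolding poly_in_def using keys_diff[of p q] by blast

lemma poly_in_mult:
  assumes "poly_in S p" "poly_in S q"
  shows "poly_in S (p * q)"
  unfolding poly_in_def
proof
  fix m assume "m \<in> Poly_Mapping.keys (p * q)"
  then obtain a b where "m = a + b" "a \<in> Poly_Mapping.keys p" "b \<in> Poly_Mapping.keys q"
    using keys_mult[of p q] by blast
  then show "Poly_Mapping.keys m \<subseteq> S"
    using assms keys_add[of a b] unfolding poly_in_def by blast
qed

section \<open>The ideal of planar squared distances\<close>

definition planar_sqdist :: "('i \<Rightarrow> 'a::comm_ring_1) \<Rightarrow> ('i \<Rightarrow> 'a) \<Rightarrow> 'i \<Rightarrow> 'i \<Rightarrow> 'a" where
  "planar_sqdist x z u v = (x u - x v)\<^sup>2 + (z u - z v)\<^sup>2"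

definition isotropic_sqdist :: "('i \<Rightarrow> 'a::comm_ring_1) \<Rightarrow> ('i \<Rightarrow> 'a) \<Rightarrow> 'i \<Rightarrow> 'i \<Rightarrow> 'a" where
  "isotropic_sqdist a b u v = (a u - a v) * (b u - b v)"

lemma isotropic_sqdist_eq_planar_sqdist:
  fixes half imag :: "'a::comm_ring_1"
  assumes "2 * half = 1" "imag\<^sup>2 = - 1"
  shows "isotropic_sqdist a b =
    planar_sqdist (\<lambda>u. half * (a u + b u)) (\<lambda>u. imag * half * (a u - b u))"
proof (intro ext)
  fix u v
  define s where "s = a u - a v"
  define t where "t = b u - b v"
  have "planar_sqdist (\<lambda>u. half * (a u + b u)) (\<lambda>u. imag * half * (a u - b u)) u v =
      (half * (s + t))\<^sup>2 + (imag * half * (s - t))\<^sup>2"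
    by (simp add: planar_sqdist_def s_def t_def algebra_simps)
  also have "\<dots> = half\<^sup>2 * ((s + t)\<^sup>2 - (s - t)\<^sup>2)"
    unfolding power_mult_distrib assms(2)
    by (simp only: right_diff_distrib mult_minus_left mult_1 add_uminus_conv_diff)
  also have "\<dots> = (2 * half)\<^sup>2 * (s * t)"
    by (simp add: power2_eq_square algebra_simps)
  finally show "isotropic_sqdist a b u v =
      planar_sqdist (\<lambda>u. half * (a u + b u)) (\<lambda>u. imag * half * (a u - b u)) u v"
    by (simp add: assms(1) isotropic_sqdist_def s_def t_def)
qed

lemma (in comm_ring_hom) hom_planar_sqdist:
  "h (planar_sqdist x z u v) = planar_sqdist (\<lambda>u. h (x u)) (\<lambda>u. h (z u)) u v"
  by (simp add: planar_sqdist_def hom_add hom_diff hom_power)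

lemma vanishing_ideal_zariski_closure:
  assumes "\<And>x i. x \<in> X \<Longrightarrow> i \<notin> S \<Longrightarrow> x i = 0"
  shows "vanishing_ideal S (zariski_closure S X) = vanishing_ideal S X"
  using assms by (auto simp: vanishing_ideal_def zariski_closure_def zero_set_def)

definition zero_ext :: "'i set \<Rightarrow> ('i \<Rightarrow> 'a::zero) \<Rightarrow> 'i \<Rightarrow> 'a" where
  "zero_ext S f i = (if i \<in> S then f i else 0)"

definition real_planar_sqdist :: "(nat \<Rightarrow> real) \<Rightarrow> (nat \<Rightarrow> real) \<Rightarrow> nat \<times> nat \<Rightarrow> complex" where
  "real_planar_sqdist x z =
    case_prod (planar_sqdist (\<lambda>u. complex_of_real (x u)) (\<lambda>u. complex_of_real (z u)))"

lemma CM_2_eq_zariski_closure_real_planar_sqdist: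
  "CM n 2 = zariski_closure (pairs n) {zero_ext (pairs n) (real_planar_sqdist x z) | x z. True}"
proof -
  define P where "P q = (\<lambda>(u, v). if (u, v) \<in> pairs n
    then complex_of_real (\<Sum>i<2. (q u i - q v i)\<^sup>2) else 0)" for q :: "nat \<Rightarrow> nat \<Rightarrow> real"
  have P: "P q = zero_ext (pairs n) (real_planar_sqdist (\<lambda>u. q u 0) (\<lambda>u. q u 1))" for q
    by (auto simp: P_def zero_ext_def real_planar_sqdist_def planar_sqdist_def numeral_2_eq_2)
  have "zero_ext (pairs n) (real_planar_sqdist x z) = P (\<lambda>u i. if i = 0 then x u else z u)" for x z
    by (simp add: P)
  with P have "{y. \<exists>q. y = P q} = {zero_ext (pairs n) (real_planar_sqdist x z) | x z. True}"
    by blast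
  then show ?thesis
    by (simp add: CM_def P_def)
qed

lemma mem_vanishing_ideal_CM_2_iff:
  "p \<in> vanishing_ideal (pairs n) (CM n 2) \<longleftrightarrow>
    poly_in (pairs n) p \<and> (\<forall>x z. mpeval id p (real_planar_sqdist x z) = 0)"
proof -
  let ?X = "{zero_ext (pairs n) (real_planar_sqdist x z) | x z. True}"
  have "vanishing_ideal (pairs n) (CM n 2) = vanishing_ideal (pairs n) ?X"
    unfolding CM_2_eq_zariski_closure_real_planar_sqdist
    by (rule vanishing_ideal_zariski_closure) (auto simp: zero_ext_def)
  moreover have "mpeval id p (zero_ext (pairs n) y) = mpeval id p y" if "poly_in (pairs n) p" for y
    by (rule mpeval_cong[OF that]) (simp add: zero_ext_def)
  then have "p \<in> vanishing_ideal (pairs n) ?X \<longleftrightarrow>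
      poly_in (pairs n) p \<and> (\<forall>x z. mpeval id p (real_planar_sqdist x z) = 0)"
    unfolding vanishing_ideal_def by fastforce
  ultimately show ?thesis
    by simp
qed

definition planar_substitution :: "mpoly \<Rightarrow> mpoly" where
  "planar_substitution p = mpeval const_mpoly p
    (case_prod (planar_sqdist (\<lambda>u. var_mpoly (u, 0)) (\<lambda>u. var_mpoly (u, 1))))"

lemma (in coeff_hom) mpeval_planar_substitution:
  "mpeval c (planar_substitution p) y =
    mpeval c p (case_prod (planar_sqdist (\<lambda>u. y (u, 0)) (\<lambda>u. y (u, 1))))"
  by (simp add: planar_substitution_def mpeval_subst mpeval.hom_planar_sqdist mpeval_var
      case_prod_unfold)

lemma (in coeff_hom) inj_coeff: "inj c"
proof (rule injI)
  fix a b assume "c a = c b"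
  then have "c ((a - b) * inverse (a - b)) = 0"
    by (simp add: hom_mult hom_diff)
  then show "a = b"
    using hom_one by (metis eq_iff_diff_eq_0 right_inverse zero_neq_one)
qed

lemma vanishing_ideal_CM_2_planar:
  fixes c :: "complex \<Rightarrow> 'a::idom" and x z :: "nat \<Rightarrow> 'a"
  assumes "coeff_hom c" and p: "p \<in> vanishing_ideal (pairs n) (CM n 2)"
  shows "mpeval c p (case_prod (planar_sqdist x z)) = 0"
proof -
  interpret coeff_hom c by fact
  let ?C = "range (\<lambda>r. c (complex_of_real r))"
  have "inj (\<lambda>r. c (complex_of_real r))"
    by (intro injI) (simp add: inj_eq[OF inj_coeff])
  then have "infinite ?C"
    using finite_imageD infinite_UNIV_char_0 by blast
  have "mpeval c (planar_substitution p) y = 0" if "range y \<subseteq> ?C" for y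
  proof -
    have "\<exists>r. y i = c (complex_of_real r)" for i
      using that by blast
    then obtain r where r: "\<And>i. y i = c (complex_of_real (r i))"
      by metis
    have "mpeval c (planar_substitution p) y =
        c (mpeval id (planar_substitution p) (\<lambda>i. complex_of_real (r i)))"
      by (simp add: hom_mpeval flip: r)
    also have "mpeval id (planar_substitution p) (\<lambda>i. complex_of_real (r i)) = 0"
      using p by (simp add: id_hom.mpeval_planar_substitution mem_vanishing_ideal_CM_2_iff
          real_planar_sqdist_def)
    finally show ?thesis
      by (simp add: hom_zero)
  qed
  then have "mpeval c (planar_substitution p) (\<lambda>(u, i). if i = 0 then x u else z u) = 0"
    by (rule mpeval_eq_0_if_zero_on_infinite_grid[OF assms(1) \<open>infinite ?C\<close>])
  then show ?thesis
    by (simp add: mpeval_planar_substitution)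
qed

lemma vanishing_ideal_CM_2_isotropic:
  fixes c :: "complex \<Rightarrow> 'a::idom" and a b :: "nat \<Rightarrow> 'a"
  assumes "coeff_hom c" "p \<in> vanishing_ideal (pairs n) (CM n 2)"
  shows "mpeval c p (case_prod (isotropic_sqdist a b)) = 0"
proof -
  interpret coeff_hom c by fact
  have "2 * c (1 / 2) = 1"
    using hom_add[of "1 / 2" "1 / 2"] by (simp add: hom_one)
  moreover have "(c \<i>)\<^sup>2 = - 1"
    using hom_diff[of 0 1] by (simp add: hom_zero hom_one flip: hom_power)
  ultimately show ?thesis
    using vanishing_ideal_CM_2_planar[OF assms] by (simp add: isotropic_sqdist_eq_planar_sqdist)
qed

section \<open>Factorization of planar squared distances\<close>

text \<open>For squared distances \<open>D\<close>, \<open>gram D p\<close> is twice the Gram matrix of the configuration with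
  origin \<open>p\<close>. Up to sign, \<open>rank_relation D p q u v w\<close> is \<open>gram D p q q\<close> times the 3x3 minor
  of that matrix with rows \<open>q, u, w\<close> and columns \<open>q, v, w\<close>.\<close>

definition gram :: "('i \<Rightarrow> 'i \<Rightarrow> 'a::comm_ring_1) \<Rightarrow> 'i \<Rightarrow> 'i \<Rightarrow> 'i \<Rightarrow> 'a" where
  "gram D p u v = D p u + D p v - D u v"

definition gram_minor :: "('i \<Rightarrow> 'i \<Rightarrow> 'a::comm_ring_1) \<Rightarrow> 'i \<Rightarrow> 'i \<Rightarrow> 'i \<Rightarrow> 'i \<Rightarrow> 'a" where
  "gram_minor D p q u v = gram D p q u * gram D p q v - gram D p q q * gram D p u v"

definition rank_relation ::
    "('i \<Rightarrow> 'i \<Rightarrow> 'a::comm_ring_1) \<Rightarrow> 'i \<Rightarrow> 'i \<Rightarrow> 'i \<Rightarrow> 'i \<Rightarrow> 'i \<Rightarrow> 'a" where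
  "rank_relation D p q u v w =
    gram_minor D p q u w * gram_minor D p q v w - gram_minor D p q w w * gram_minor D p q u v"

lemma (in comm_ring_hom) hom_gram_minor:
  "h (gram_minor D p q u v) = gram_minor (\<lambda>u v. h (D u v)) p q u v"
  by (simp only: gram_minor_def gram_def hom_add hom_diff hom_mult)

lemma (in comm_ring_hom) hom_rank_relation:
  "h (rank_relation D p q u v w) = rank_relation (\<lambda>u v. h (D u v)) p q u v w"
  by (simp add: rank_relation_def hom_gram_minor hom_diff hom_mult)

definition triangle_det :: "('i \<Rightarrow> 'a::comm_ring_1) \<Rightarrow> ('i \<Rightarrow> 'a) \<Rightarrow> 'i \<Rightarrow> 'i \<Rightarrow> 'i \<Rightarrow> 'a" where
  "triangle_det x z p q u = (x q - x p) * (z u - z p) - (x u - x p) * (z q - z p)"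

lemma gram_minor_planar_sqdist:
  "gram_minor (planar_sqdist x z) p q u v = - 4 * triangle_det x z p q u * triangle_det x z p q v"
  by (simp add: gram_minor_def gram_def planar_sqdist_def triangle_det_def power2_eq_square
      algebra_simps)

lemma rank_relation_planar_sqdist: "rank_relation (planar_sqdist x z) p q u v w = 0"
  by (simp add: rank_relation_def gram_minor_planar_sqdist)

definition sym_matrix :: "(nat \<times> nat \<Rightarrow> 'a::zero) \<Rightarrow> nat \<Rightarrow> nat \<Rightarrow> 'a" where
  "sym_matrix y u v = (if u = v then 0 else y (min u v, max u v))"

lemma sym_matrix_case_prod:
  assumes "\<And>u v. D u v = D v u" "\<And>u. D u u = 0"
  shows "sym_matrix (case_prod D) = D"
  using assms by (auto simp: fun_eq_iff sym_matrix_def min_def max_def)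

lemma (in comm_ring_hom) hom_sym_matrix:
  "h (sym_matrix y u v) = sym_matrix (\<lambda>i. h (y i)) u v"
  by (simp add: sym_matrix_def hom_zero)

lemma (in coeff_hom) mpeval_rank_relation_var:
  "mpeval c (rank_relation (sym_matrix var_mpoly) p q u v w) y =
    rank_relation (sym_matrix y) p q u v w"
  by (simp add: mpeval.hom_rank_relation mpeval.hom_sym_matrix mpeval_var)

lemma min_max_in_pairs: "u \<in> {1..n} \<Longrightarrow> v \<in> {1..n} \<Longrightarrow> u \<noteq> v \<Longrightarrow> (min u v, max u v) \<in> pairs n"
  by (auto simp: pairs_def)

lemma poly_in_rank_relation_var:
  assumes "{p, q, u, v, w} \<subseteq> {1..n}"
  shows "poly_in (pairs n) (rank_relation (sym_matrix var_mpoly) p q u v w)"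
proof -
  have "poly_in (pairs n) (sym_matrix var_mpoly u v)" if "u \<in> {1..n}" "v \<in> {1..n}" for u v
    using that by (simp add: sym_matrix_def poly_in_zero poly_in_var min_max_in_pairs)
  with assms show ?thesis
    unfolding rank_relation_def gram_minor_def gram_def
    by (intro poly_in_diff poly_in_mult poly_in_add) auto
qed

lemma rank_relation_in_vanishing_ideal_CM_2:
  assumes "{p, q, u, v, w} \<subseteq> {1..n}"
  shows "rank_relation (sym_matrix var_mpoly) p q u v w \<in> vanishing_ideal (pairs n) (CM n 2)"
proof -
  have "sym_matrix (case_prod (planar_sqdist x z)) = planar_sqdist x z" for x z :: "nat \<Rightarrow> complex"
    by (rule sym_matrix_case_prod) (simp_all add: planar_sqdist_def power2_commute)
  with poly_in_rank_relation_var[OF assms] show ?thesis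
    by (simp add: mem_vanishing_ideal_CM_2_iff real_planar_sqdist_def rank_relation_planar_sqdist
        id_hom.mpeval_rank_relation_var)
qed

lemma symmetric_rank_one_factorization:
  fixes M :: "'i \<Rightarrow> 'i \<Rightarrow> 'a::field"
  assumes minors: "\<And>u v w. u \<in> A \<Longrightarrow> v \<in> A \<Longrightarrow> w \<in> A \<Longrightarrow> M u w * M v w = M w w * M u v"
    and root: "\<And>w. w \<in> A \<Longrightarrow> \<exists>r. r\<^sup>2 = M w w"
  obtains e where "\<And>u v. u \<in> A \<Longrightarrow> v \<in> A \<Longrightarrow> M u v = e u * e v"
proof (cases "\<exists>w\<in>A. M w w \<noteq> 0")
  case True
  then obtain w where w: "w \<in> A" "M w w \<noteq> 0"
    by blast
  obtain r where r: "r * r = M w w"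
    using root[OF w(1)] by (auto simp: power2_eq_square)
  show ?thesis
  proof
    fix u v assume "u \<in> A" "v \<in> A"
    then show "M u v = (M u w / r) * (M v w / r)"
      using minors[of u v w] w r by simp
  qed
next
  case False
  show ?thesis
  proof
    fix u v assume "u \<in> A" "v \<in> A"
    then show "M u v = 0 * 0"
      using minors[of u u v] False by simp
  qed
qed

lemma isotropic_coordinates_of_gram_minor:
  fixes D :: "'i \<Rightarrow> 'i \<Rightarrow> 'a::field_char_0"
  assumes "D p q \<noteq> 0" and diag: "\<And>u. D u u = 0"
    and minor: "\<And>u v. u \<in> A \<Longrightarrow> v \<in> A \<Longrightarrow> gram_minor D p q u v = e u * e v"
  obtains a b where "\<And>u v. u \<in> A \<Longrightarrow> v \<in> A \<Longrightarrow> D u v = isotropic_sqdist a b u v"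
proof -
  define g where "g = gram D p q"
  define a where "a u = (g u + e u) / g q" for u
  define b where "b u = (g u - e u) / 2" for u
  have gq: "g q \<noteq> 0"
    using assms(1) by (simp add: g_def gram_def diag)
  have "D u v = isotropic_sqdist a b u v" if uv: "u \<in> A" "v \<in> A" for u v
  proof -
  have "a u - a v = (g u - g v + (e u - e v)) / g q" "b u - b v = (g u - g v - (e u - e v)) / 2"
    by (simp_all add: a_def b_def flip: diff_divide_distrib)
  then have "2 * g q * isotropic_sqdist a b u v =
      (g u - g v + (e u - e v)) * (g u - g v - (e u - e v))"
    using gq by (simp only: isotropic_sqdist_def) simp
  also have "\<dots> = (g u * g u - e u * e u) + (g v * g v - e v * e v) - 2 * (g u * g v - e u * e v)"
    by (simp add: algebra_simps)
  also have "\<dots> = g q * (gram D p u u + gram D p v v - 2 * gram D p u v)"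
    unfolding minor[OF uv, symmetric] minor[OF uv(1,1), symmetric] minor[OF uv(2,2), symmetric]
    by (simp add: gram_minor_def g_def algebra_simps)
  also have "\<dots> = 2 * g q * D u v"
    by (simp add: gram_def diag)
  finally show ?thesis
    using gq by simp
  qed
  then show ?thesis
    by (rule that)
qed

lemma isotropic_coordinates_of_rank_relation:
  fixes D :: "'i \<Rightarrow> 'i \<Rightarrow> 'a::field_char_0"
  assumes "D p q \<noteq> 0" "\<And>u. D u u = 0"
    and relation: "\<And>u v w. u \<in> A \<Longrightarrow> v \<in> A \<Longrightarrow> w \<in> A \<Longrightarrow> rank_relation D p q u v w = 0"
    and root: "\<And>w. w \<in> A \<Longrightarrow> \<exists>r. r\<^sup>2 = gram_minor D p q w w"
  obtains a b where "\<And>u v. u \<in> A \<Longrightarrow> v \<in> A \<Longrightarrow> D u v = isotropic_sqdist a b u v"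
proof -
  have minors: "gram_minor D p q u w * gram_minor D p q v w =
      gram_minor D p q w w * gram_minor D p q u v"
    if "u \<in> A" "v \<in> A" "w \<in> A" for u v w
    using relation[OF that] by (simp add: rank_relation_def)
  obtain e where e: "\<And>u v. u \<in> A \<Longrightarrow> v \<in> A \<Longrightarrow> gram_minor D p q u v = e u * e v"
    using symmetric_rank_one_factorization[where M = "gram_minor D p q", OF minors root] by blast
  show ?thesis
    using isotropic_coordinates_of_gram_minor[where D = D, OF assms(1,2) e] that by blast
qed

section \<open>Laurent series\<close>

lemma fls_square_root_exists:
  fixes f :: "'a::{alg_closed_field, field_char_0} fls"
  assumes "even (fls_subdegree f)"
  shows "\<exists>r. r\<^sup>2 = f"
proof (cases "f = 0")
  case True
  then show ?thesis by (intro exI[of _ 0]) simp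
next
  case False
  define F where "F = fls_base_factor_to_fps f"
  have F0: "F $ 0 \<noteq> 0"
    using False by (simp add: F_def)
  obtain s where s: "s\<^sup>2 = F $ 0"
    using nth_root_exists[of 2 "F $ 0"] by auto
  define H where "H = fps_radical (\<lambda>_ _. s) 2 F"
  have "H\<^sup>2 = F"
    using power_radical[OF F0, of "\<lambda>_ _. s" 1] s by (simp add: H_def numeral_2_eq_2)
  obtain k where k: "fls_subdegree f = 2 * k"
    using assms by blast
  have "f = fps_to_fls F * fls_X_intpow (2 * k)"
    using fls_base_factor_X_power_decompose(1)[of f] False
    by (simp add: F_def fls_base_factor_to_fps_to_fls flip: k)
  also have "\<dots> = (fps_to_fls H * fls_X_intpow k)\<^sup>2"
    by (simp add: power_mult_distrib fls_X_intpow_power flip: \<open>H\<^sup>2 = F\<close> fps_to_fls_power)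
  finally show ?thesis by metis
qed

lemma fls_nth_compose_power_subdegree:
  "d > 0 \<Longrightarrow> fls_compose_power f d $$ (int d * fls_subdegree f) = f $$ fls_subdegree f"
  by (simp add: fls_nth_compose_power)

lemma fls_compose_power_eq_0_iff:
  assumes "d > 0"
  shows "fls_compose_power f d = 0 \<longleftrightarrow> f = 0"
  using fls_nth_compose_power_subdegree[OF assms, of f] by (auto simp: nth_fls_subdegree_zero_iff)

lemma fls_subdegree_compose_power: "fls_subdegree (fls_compose_power f d) = int d * fls_subdegree f"
proof (cases "d = 0 \<or> f = 0")
  case False
  show ?thesis
  proof (rule fls_subdegree_eqI)
    show "fls_compose_power f d $$ (int d * fls_subdegree f) \<noteq> 0"
      using False by (simp add: fls_nth_compose_power_subdegree)
    show "fls_compose_power f d $$ k = 0" if "k < int d * fls_subdegree f" for k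
      using False that by (auto simp: fls_nth_compose_power)
  qed
qed auto

lemma comm_ring_hom_fls_compose_power:
  "d > 0 \<Longrightarrow> comm_ring_hom (\<lambda>f :: 'a::idom fls. fls_compose_power f d)"
  by unfold_locales auto

section \<open>Ultrametrics\<close>

definition ultrametric_on :: "'i set \<Rightarrow> ('i \<Rightarrow> 'i \<Rightarrow> 'a::linorder) \<Rightarrow> bool" where
  "ultrametric_on A d \<longleftrightarrow> (\<forall>u\<in>A. \<forall>v\<in>A. d u v = d v u) \<and>
    (\<forall>u\<in>A. \<forall>v\<in>A. \<forall>w\<in>A. u \<noteq> v \<and> u \<noteq> w \<and> v \<noteq> w \<longrightarrow> d u v \<le> max (d u w) (d v w))"

lemma ultrametric_on_sym: "ultrametric_on A d \<Longrightarrow> u \<in> A \<Longrightarrow> v \<in> A \<Longrightarrow> d u v = d v u"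
  by (simp add: ultrametric_on_def)

lemma ultrametric_on_triangle:
  "ultrametric_on A d \<Longrightarrow> u \<in> A \<Longrightarrow> v \<in> A \<Longrightarrow> w \<in> A \<Longrightarrow> u \<noteq> v \<Longrightarrow> u \<noteq> w \<Longrightarrow> v \<noteq> w \<Longrightarrow>
    d u v \<le> max (d u w) (d v w)"
  by (simp add: ultrametric_on_def)

lemma ultrametric_on_order_preserving:
  assumes "ultrametric_on A d" "\<And>u v. u \<in> A \<Longrightarrow> v \<in> A \<Longrightarrow> d' u v = d' v u"
    and mono: "\<And>u v s t. u \<in> A \<Longrightarrow> v \<in> A \<Longrightarrow> s \<in> A \<Longrightarrow> t \<in> A \<Longrightarrow> u \<noteq> v \<Longrightarrow> s \<noteq> t \<Longrightarrow>
      d u v \<le> d s t \<Longrightarrow> d' u v \<le> d' s t"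
  shows "ultrametric_on A d'"
  unfolding ultrametric_on_def
proof (intro conjI ballI impI)
  fix u v w assume uvw: "u \<in> A" "v \<in> A" "w \<in> A" "u \<noteq> v \<and> u \<noteq> w \<and> v \<noteq> w"
  then have "d u v \<le> d u w \<or> d u v \<le> d v w"
    using ultrametric_on_triangle[OF assms(1), of u v w] by (simp add: le_max_iff_disj)
  with uvw show "d' u v \<le> max (d' u w) (d' v w)"
    using mono[of u v u w] mono[of u v v w] by (auto simp: le_max_iff_disj)
qed (use assms(2) in blast)

lemma ultrametric_on_compose_mono:
  assumes "ultrametric_on A d" "mono f"
  shows "ultrametric_on A (\<lambda>u v. f (d u v))"
  using assms(1)
proof (rule ultrametric_on_order_preserving)
  show "f (d u v) = f (d v u)" if "u \<in> A" "v \<in> A" for u v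
    by (simp add: ultrametric_on_sym[OF assms(1) that])
qed (use assms(2) in \<open>auto dest: monoD\<close>)

lemma ultrametric_on_fls_subdegree_diff:
  fixes a :: "'i \<Rightarrow> 'a::ab_group_add fls"
  assumes "inj_on a A"
  shows "ultrametric_on A (\<lambda>u v. - fls_subdegree (a u - a v))"
  unfolding ultrametric_on_def
proof (intro conjI ballI impI)
  show "- fls_subdegree (a u - a v) = - fls_subdegree (a v - a u)" for u v
    by (simp add: fls_subdegree_minus_sym)
  fix u v w assume "u \<in> A" "v \<in> A" "u \<noteq> v \<and> u \<noteq> w \<and> v \<noteq> w"
  then have "(a u - a w) + (a w - a v) \<noteq> 0"
    using assms by (auto dest: inj_onD)
  then have "min (fls_subdegree (a u - a w)) (fls_subdegree (a v - a w)) \<le>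
      fls_subdegree (a u - a v)"
    using fls_plus_subdegree[of "a u - a w" "a w - a v"]
      fls_subdegree_minus_sym[of "a v" "a w"] by simp
  then show "- fls_subdegree (a u - a v) \<le>
      max (- fls_subdegree (a u - a w)) (- fls_subdegree (a v - a w))"
    by linarith
qed

definition ultra_ball :: "'i set \<Rightarrow> ('i \<Rightarrow> 'i \<Rightarrow> 'a::linorder) \<Rightarrow> 'a \<Rightarrow> 'i \<Rightarrow> 'i set" where
  "ultra_ball A d r u = {w \<in> A. w = u \<or> d u w < r}"

lemma ultra_ball_subset:
  assumes ultra: "ultrametric_on A d" and "u \<in> A" "v \<in> A" "u \<noteq> v" "d u v < r"
  shows "ultra_ball A d r u \<subseteq> ultra_ball A d r v"
proof
  fix w assume "w \<in> ultra_ball A d r u"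
  then have w: "w \<in> A" "w = u \<or> d u w < r"
    by (auto simp: ultra_ball_def)
  have "d v w < r" if "w \<noteq> v"
  proof (cases "w = u")
    case True
    then show ?thesis
      using ultrametric_on_sym[OF ultra, of u v] assms by simp
  next
    case False
    have "d v w \<le> max (d v u) (d w u)"
      using ultrametric_on_triangle[OF ultra] assms w(1) that False by simp
    also have "\<dots> = max (d u v) (d u w)"
      using ultrametric_on_sym[OF ultra] assms w(1) by simp
    also have "\<dots> < r"
      using \<open>d u v < r\<close> w(2) False by simp
    finally show ?thesis .
  qed
  with w(1) show "w \<in> ultra_ball A d r v"
    by (auto simp: ultra_ball_def)
qed

lemma ultra_ball_eq_iff:
  assumes "ultrametric_on A d" "u \<in> A" "v \<in> A" "u \<noteq> v"
  shows "ultra_ball A d r u = ultra_ball A d r v \<longleftrightarrow> d u v < r"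
proof
  assume "ultra_ball A d r u = ultra_ball A d r v"
  then have "v \<in> ultra_ball A d r u"
    using assms by (simp add: ultra_ball_def)
  then show "d u v < r"
    using assms(4) by (simp add: ultra_ball_def)
next
  assume "d u v < r"
  then show "ultra_ball A d r u = ultra_ball A d r v"
    using ultra_ball_subset[of A d u v r] ultra_ball_subset[of A d v u r] assms
      ultrametric_on_sym[OF assms(1-3)] by auto
qed

lemma exists_fls_subdegree_diff_eq_ultrametric:
  fixes d :: "'i \<Rightarrow> 'i \<Rightarrow> int"
  assumes "finite A" and ultra: "ultrametric_on A d"
  obtains a :: "'i \<Rightarrow> 'a::ring_char_0 fls" where "inj_on a A"
    "\<And>u v. u \<in> A \<Longrightarrow> v \<in> A \<Longrightarrow> u \<noteq> v \<Longrightarrow> - fls_subdegree (a u - a v) = d u v"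
proof -
  obtain label :: "'i set \<Rightarrow> nat" where label: "inj_on label (Pow A)"
    using finite_imp_inj_to_nat_seg[of "Pow A"] \<open>finite A\<close> by auto
  define m where "m = Max ((\<lambda>(u, v). d u v) ` (A \<times> A))"
  have m: "d u v \<le> m" if "u \<in> A" "v \<in> A" for u v
    unfolding m_def using that \<open>finite A\<close> by (intro Max_ge) auto
  define a :: "'i \<Rightarrow> 'a fls" where
    "a u = Abs_fls (\<lambda>k. if k < - m then 0 else of_nat (label (ultra_ball A d (- k) u)))" for u
  have nth: "a u $$ k = (if k < - m then 0 else of_nat (label (ultra_ball A d (- k) u)))" for u k
    unfolding a_def by (rule nth_Abs_fls_lower_bound[of "- m"]) simp
  have coeff_eq: "(a u - a v) $$ k = 0 \<longleftrightarrow> k < - d u v" if "u \<in> A" "v \<in> A" "u \<noteq> v" for u v k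
  proof -
    have "label (ultra_ball A d (- k) u) = label (ultra_ball A d (- k) v) \<longleftrightarrow>
        ultra_ball A d (- k) u = ultra_ball A d (- k) v"
      by (rule inj_on_eq_iff[OF label]) (auto simp: ultra_ball_def)
    then show ?thesis
      using ultra_ball_eq_iff[OF ultra that] m[OF that(1,2)] by (auto simp: nth)
  qed
  show ?thesis
  proof (rule that)
    show "inj_on a A"
    proof (rule inj_onI, rule ccontr)
      fix u v assume "u \<in> A" "v \<in> A" "a u = a v" "u \<noteq> v"
      then show False
        using coeff_eq[of u v "- d u v"] by simp
    qed
    show "- fls_subdegree (a u - a v) = d u v" if "u \<in> A" "v \<in> A" "u \<noteq> v" for u v
      using fls_subdegree_eqI[of "a u - a v" "- d u v"] coeff_eq[OF that] by simp
  qed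
qed

lemma mem_ultrametrics_iff:
  "\<delta> \<in> ultrametrics n \<longleftrightarrow> (\<forall>i. i \<notin> pairs n \<longrightarrow> \<delta> i = 0) \<and> ultrametric_on {1..n} (dist_pair \<delta>)"
  by (auto simp: ultrametrics_def ultrametric_on_def dist_pair_def min.commute max.commute)

lemma ultrametrics_eq_0: "\<delta> \<in> ultrametrics n \<Longrightarrow> i \<notin> pairs n \<Longrightarrow> \<delta> i = 0"
  unfolding mem_ultrametrics_iff by blast

lemma ultrametric_on_dist_pair: "\<delta> \<in> ultrametrics n \<Longrightarrow> ultrametric_on {1..n} (dist_pair \<delta>)"
  by (simp add: mem_ultrametrics_iff)

lemma zero_ext_in_ultrametrics:
  assumes "ultrametric_on {1..n} d"
  shows "zero_ext (pairs n) (case_prod d) \<in> ultrametrics n"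
proof -
  have "dist_pair (zero_ext (pairs n) (case_prod d)) u v = d u v"
    if "u \<in> {1..n}" "v \<in> {1..n}" "u \<noteq> v" for u v
    using that min_max_in_pairs[OF that] ultrametric_on_sym[OF assms that(1,2)]
    by (auto simp: dist_pair_def zero_ext_def min_def max_def)
  with assms have "ultrametric_on {1..n} (dist_pair (zero_ext (pairs n) (case_prod d)))"
    by (auto intro: ultrametric_on_order_preserving simp: dist_pair_def min.commute max.commute)
  then show ?thesis
    by (simp add: mem_ultrametrics_iff zero_ext_def)
qed

lemma ultrametrics_order_preserving:
  assumes "\<delta> \<in> ultrametrics n" "\<And>i. i \<notin> pairs n \<Longrightarrow> \<delta>' i = 0"
    and "\<And>i j. i \<in> pairs n \<Longrightarrow> j \<in> pairs n \<Longrightarrow> \<delta> i \<le> \<delta> j \<Longrightarrow> \<delta>' i \<le> \<delta>' j"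
  shows "\<delta>' \<in> ultrametrics n"
proof -
  have "ultrametric_on {1..n} (dist_pair \<delta>')"
    using ultrametric_on_dist_pair[OF assms(1)]
    by (rule ultrametric_on_order_preserving)
      (auto intro!: assms(3) min_max_in_pairs simp: dist_pair_def min.commute max.commute)
  with assms(2) show ?thesis
    by (simp add: mem_ultrametrics_iff)
qed

section \<open>Closedness of the set of sums of two ultrametrics\<close>

lemma measure_lborel_Int_atMost_diff:
  fixes s t :: real
  assumes "U \<in> fmeasurable lborel" "s \<le> t"
  shows "measure lborel (U \<inter> {..t}) - measure lborel (U \<inter> {..s}) = measure lborel (U \<inter> {s<..t})"
proof -
  have "U \<in> sets borel"
    using fmeasurableD[OF assms(1)] by simp
  then have "measure lborel (U \<inter> {..t} - U \<inter> {..s}) =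
      measure lborel (U \<inter> {..t}) - measure lborel (U \<inter> {..s})"
    using assms by (intro measurable_measure_Diff fmeasurable_Int_fmeasurable) auto
  moreover have "U \<inter> {..t} - U \<inter> {..s} = U \<inter> {s<..t}"
    by auto
  ultimately show ?thesis
    by simp
qed

lemma measure_lborel_UN_Icc_le:
  fixes A :: "real set"
  assumes "finite A" "0 \<le> L"
  shows "measure lborel (\<Union>a\<in>A. {a..a + L}) \<le> L * real (card A)"
proof -
  have "measure lborel (\<Union>a\<in>A. {a..a + L}) \<le> (\<Sum>a\<in>A. measure lborel {a..a + L})"
    using \<open>finite A\<close> by (intro measure_UNION_le) auto
  also have "\<dots> = L * real (card A)"
    using \<open>0 \<le> L\<close> by simp
  finally show ?thesis .
qed

lemma gap_compression:
  fixes A :: "real set"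
  assumes "finite A" "0 \<le> L"
  obtains \<phi> :: "real \<Rightarrow> real" where
    "\<And>s t. s \<le> t \<Longrightarrow> \<phi> s \<le> \<phi> t" "\<And>s t. s \<le> t \<Longrightarrow> \<phi> t - \<phi> s \<le> t - s"
    "\<And>s t. s \<in> A \<Longrightarrow> s \<le> t \<Longrightarrow> min L (t - s) \<le> \<phi> t - \<phi> s"
    "\<And>t. 0 \<le> \<phi> t" "\<And>t. \<phi> t \<le> L * real (card A)"
proof
  define U where "U = (\<Union>a\<in>A. {a..a + L})"
  define \<phi> where "\<phi> t = measure lborel (U \<inter> {..t})" for t
  have U: "U \<in> fmeasurable lborel"
    unfolding U_def using \<open>finite A\<close>
    by (intro fmeasurable.finite_UN) (auto simp: fmeasurable_def emeasure_lborel_Icc_eq)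
  have borel: "U \<in> sets borel"
    using fmeasurableD[OF U] by simp
  have increment: "\<phi> t - \<phi> s = measure lborel (U \<inter> {s<..t})" if "s \<le> t" for s t
    unfolding \<phi>_def using U that by (rule measure_lborel_Int_atMost_diff)
  show "\<phi> s \<le> \<phi> t" if "s \<le> t" for s t
    using increment[OF that] measure_nonneg[of lborel "U \<inter> {s<..t}"] by linarith
  show "\<phi> t - \<phi> s \<le> t - s" if "s \<le> t" for s t
    using measure_mono_fmeasurable[of "U \<inter> {s<..t}" "{s<..t}" lborel] that borel
    by (simp add: increment fmeasurable_def emeasure_lborel_Ioc)
  show "min L (t - s) \<le> \<phi> t - \<phi> s" if "s \<in> A" "s \<le> t" for s t
  proof -
    have "{s..s + L} \<subseteq> U"
      using \<open>s \<in> A\<close> by (auto simp: U_def)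
    then have "{s<..min (s + L) t} \<subseteq> U \<inter> {s<..t}"
      by (auto simp: subset_iff)
    then have "measure lborel {s<..min (s + L) t} \<le> measure lborel (U \<inter> {s<..t})"
      using U by (intro measure_mono_fmeasurable fmeasurable_Int_fmeasurable) auto
    then show ?thesis
      using \<open>s \<le> t\<close> \<open>0 \<le> L\<close> by (simp add: increment min_def split: if_splits)
  qed
  show "0 \<le> \<phi> t" for t
    by (simp add: \<phi>_def)
  show "\<phi> t \<le> L * real (card A)" for t
  proof -
    have "\<phi> t \<le> measure lborel U"
      unfolding \<phi>_def using U by (intro measure_mono_fmeasurable) (auto simp: fmeasurableD)
    also have "\<dots> \<le> L * real (card A)"
      unfolding U_def using assms by (rule measure_lborel_UN_Icc_le)
    finally show ?thesis .
  qed
qed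

text \<open>Where the sum is bounded by \<open>M\<close>, two values of \<open>\<alpha>\<close> with a gap of more than \<open>2 * M\<close> between
  them correspond to values of \<open>\<beta>\<close> in the opposite order, so that the gap can be shortened.\<close>

lemma bounded_order_preserving_summands:
  fixes \<alpha> \<beta> :: "'i \<Rightarrow> real"
  assumes "finite I" "0 \<le> M" and sum: "\<And>i. i \<in> I \<Longrightarrow> \<bar>\<alpha> i + \<beta> i\<bar> \<le> M"
  obtains \<gamma> where "\<And>i. \<bar>\<gamma> i\<bar> \<le> 2 * M * real (card I)"
    "\<And>i j. i \<in> I \<Longrightarrow> j \<in> I \<Longrightarrow> \<alpha> i \<le> \<alpha> j \<Longrightarrow> \<gamma> i \<le> \<gamma> j"
    "\<And>i j. i \<in> I \<Longrightarrow> j \<in> I \<Longrightarrow> \<beta> i \<le> \<beta> j \<Longrightarrow> \<alpha> i + \<beta> i - \<gamma> i \<le> \<alpha> j + \<beta> j - \<gamma> j"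
proof -
  have "finite (\<alpha> ` I)" "0 \<le> 2 * M"
    using assms(1,2) by auto
  then obtain \<phi> where \<phi>: "\<And>s t. s \<le> t \<Longrightarrow> \<phi> s \<le> \<phi> t" "\<And>s t. s \<le> t \<Longrightarrow> \<phi> t - \<phi> s \<le> t - s"
      "\<And>s t. s \<in> \<alpha> ` I \<Longrightarrow> s \<le> t \<Longrightarrow> min (2 * M) (t - s) \<le> \<phi> t - \<phi> s"
      "\<And>t. 0 \<le> \<phi> t" "\<And>t. \<phi> t \<le> 2 * M * real (card (\<alpha> ` I))"
    by (rule gap_compression) (rule that)
  have "\<phi> t \<le> 2 * M * real (card I)" for t
    using \<phi>(5)[of t] mult_left_mono[of "real (card (\<alpha> ` I))" "real (card I)" "2 * M"] assms(1,2)
    by (simp add: card_image_le)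
  with \<phi>(4) have bound: "\<bar>\<phi> (\<alpha> i)\<bar> \<le> 2 * M * real (card I)" for i
    by (simp add: abs_of_nonneg)
  have \<beta>_mono: "\<alpha> i + \<beta> i - \<phi> (\<alpha> i) \<le> \<alpha> j + \<beta> j - \<phi> (\<alpha> j)"
    if "i \<in> I" "j \<in> I" "\<beta> i \<le> \<beta> j" for i j
  proof (cases "\<alpha> i \<le> \<alpha> j")
    case True
    then show ?thesis
      using \<phi>(2)[OF True] that(3) by linarith
  next
    case False
    then have "min (2 * M) (\<alpha> i - \<alpha> j) \<le> \<phi> (\<alpha> i) - \<phi> (\<alpha> j)"
      using \<phi>(3) \<open>j \<in> I\<close> by simp
    moreover have "\<alpha> i + \<beta> i - (\<alpha> j + \<beta> j) \<le> 2 * M"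
      using sum[OF \<open>i \<in> I\<close>] sum[OF \<open>j \<in> I\<close>] by linarith
    ultimately show ?thesis
      using that(3) by linarith
  qed
  show ?thesis
    by (rule that[of "\<lambda>i. \<phi> (\<alpha> i)"])
      (use bound \<beta>_mono \<phi>(1) in auto)
qed

lemma tendsto_fun_iff:
  fixes f :: "'a \<Rightarrow> 'b \<Rightarrow> 'c::topological_space"
  shows "(f \<longlongrightarrow> l) F \<longleftrightarrow> (\<forall>i. ((\<lambda>x. f x i) \<longlongrightarrow> l i) F)"
proof -
  have "(f \<longlongrightarrow> l) F \<longleftrightarrow> limitin (product_topology (\<lambda>i. euclidean) UNIV) f l F"
    by (simp add: euclidean_product_topology)
  then show ?thesis
    by (simp add: limitin_componentwise)
qed

lemma LIMSEQ_fun_imp_bounded: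
  fixes f :: "nat \<Rightarrow> 'i \<Rightarrow> real"
  assumes "f \<longlonglongrightarrow> l"
  obtains M where "\<And>k i. \<bar>f k i\<bar> \<le> M i"
proof -
  have "\<exists>M. \<forall>k. \<bar>f k i\<bar> \<le> M" for i
  proof -
    have "Bseq (\<lambda>k. f k i)"
      using assms by (intro convergent_imp_Bseq) (auto simp: tendsto_fun_iff convergent_def)
    then show ?thesis
      by (auto simp: Bseq_def)
  qed
  then show ?thesis
    using that by metis
qed

lemma compact_Pi_UNIV:
  fixes K :: "'i \<Rightarrow> 'a::topological_space set"
  assumes "\<And>i. compact (K i)"
  shows "compact (Pi UNIV K)"
  using assms compactin_PiE[of "\<lambda>_. euclidean" UNIV K]
  by (simp add: euclidean_product_topology PiE_UNIV_domain Pi_def)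

lemma bounded_fun_sequence_convergent_subseq:
  fixes f :: "nat \<Rightarrow> 'i::countable \<Rightarrow> real"
  assumes "\<And>k i. \<bar>f k i\<bar> \<le> B i"
  obtains l r where "strict_mono r" "(f \<circ> r) \<longlonglongrightarrow> l"
proof -
  have "seq_compact (\<Pi> i\<in>UNIV. {- B i..B i})"
    by (intro compact_imp_seq_compact compact_Pi_UNIV compact_Icc)
  moreover have "f k \<in> (\<Pi> i\<in>UNIV. {- B i..B i})" for k
    using assms by (auto simp: abs_le_iff minus_le_iff)
  ultimately show ?thesis
    using that by (metis seq_compactE)
qed

lemma closed_sum_if_bounded_summands:
  fixes U V :: "('i::countable \<Rightarrow> real) set"
  assumes "closed U" "closed V"
    and bounded_summands: "\<And>M. \<exists>B. \<forall>\<alpha>\<in>U. \<forall>\<beta>\<in>V. (\<forall>i. \<bar>\<alpha> i + \<beta> i\<bar> \<le> M i) \<longrightarrow>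
      (\<exists>\<gamma>\<in>U. (\<lambda>i. \<alpha> i + \<beta> i - \<gamma> i) \<in> V \<and> (\<forall>i. \<bar>\<gamma> i\<bar> \<le> B i))"
  shows "closed {(\<lambda>i. \<alpha> i + \<beta> i) | \<alpha> \<beta>. \<alpha> \<in> U \<and> \<beta> \<in> V}" (is "closed ?W")
  unfolding closed_sequential_limits
proof (intro allI impI, elim conjE)
  fix x l assume mem: "\<forall>k. x k \<in> ?W" and lim: "x \<longlonglongrightarrow> l"
  obtain M where M: "\<And>k i. \<bar>x k i\<bar> \<le> M i"
    using LIMSEQ_fun_imp_bounded[OF lim] by blast
  obtain B where B: "\<And>\<alpha> \<beta>. \<alpha> \<in> U \<Longrightarrow> \<beta> \<in> V \<Longrightarrow> (\<forall>i. \<bar>\<alpha> i + \<beta> i\<bar> \<le> M i) \<Longrightarrow>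
      \<exists>\<gamma>\<in>U. (\<lambda>i. \<alpha> i + \<beta> i - \<gamma> i) \<in> V \<and> (\<forall>i. \<bar>\<gamma> i\<bar> \<le> B i)"
    using bounded_summands[of M] by blast
  have "\<exists>\<gamma>. \<gamma> \<in> U \<and> (\<lambda>i. x k i - \<gamma> i) \<in> V \<and> (\<forall>i. \<bar>\<gamma> i\<bar> \<le> B i)" for k
  proof -
    obtain \<alpha> \<beta> where "x k = (\<lambda>i. \<alpha> i + \<beta> i)" "\<alpha> \<in> U" "\<beta> \<in> V"
      using mem by blast
    then show ?thesis
      using B[of \<alpha> \<beta>] M[of k] by auto
  qed
  then obtain \<gamma> where \<gamma>: "\<And>k. \<gamma> k \<in> U" "\<And>k. (\<lambda>i. x k i - \<gamma> k i) \<in> V"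
      "\<And>k i. \<bar>\<gamma> k i\<bar> \<le> B i"
    by metis
  obtain c r where r: "strict_mono r" "(\<gamma> \<circ> r) \<longlonglongrightarrow> c"
    using bounded_fun_sequence_convergent_subseq[of \<gamma> B] \<gamma>(3) by blast
  have "(\<lambda>k. x (r k) i) \<longlonglongrightarrow> l i" for i
    using LIMSEQ_subseq_LIMSEQ[OF lim r(1)] by (simp add: tendsto_fun_iff)
  then have "(\<lambda>k. x (r k) i - \<gamma> (r k) i) \<longlonglongrightarrow> l i - c i" for i
    using r(2) by (intro tendsto_diff) (auto simp: tendsto_fun_iff)
  then have "(\<lambda>k i. x (r k) i - \<gamma> (r k) i) \<longlonglongrightarrow> (\<lambda>i. l i - c i)"
    by (simp add: tendsto_fun_iff)
  then have "(\<lambda>i. l i - c i) \<in> V"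
    using closed_sequentially[OF \<open>closed V\<close>, of "\<lambda>k i. x (r k) i - \<gamma> (r k) i"] \<gamma>(2) by simp
  moreover have "c \<in> U"
    using closed_sequentially[OF \<open>closed U\<close> _ r(2)] \<gamma>(1) by simp
  ultimately show "l \<in> ?W"
    by (intro CollectI exI[of _ c] exI[of _ "\<lambda>i. l i - c i"]) auto
qed

lemma closed_ultrametrics: "closed (ultrametrics n)"
  unfolding ultrametrics_def dist_pair_def Ball_def
  by (intro closed_Collect_conj closed_Collect_all closed_Collect_imp
      closed_Collect_eq closed_Collect_le open_Collect_const continuous_intros
      continuous_on_product_coordinates)

lemma finite_pairs: "finite (pairs n)"
  by (rule finite_subset[of _ "{1..n} \<times> {1..n}"]) (auto simp: pairs_def)

lemma bounded_ultrametrics_summands: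
  assumes \<alpha>: "\<alpha> \<in> ultrametrics n" and \<beta>: "\<beta> \<in> ultrametrics n"
    and "0 \<le> M" and bounded: "\<And>i. i \<in> pairs n \<Longrightarrow> \<bar>\<alpha> i + \<beta> i\<bar> \<le> M"
  shows "\<exists>\<gamma>\<in>ultrametrics n. (\<lambda>i. \<alpha> i + \<beta> i - \<gamma> i) \<in> ultrametrics n \<and>
    (\<forall>i. \<bar>\<gamma> i\<bar> \<le> 2 * M * real (card (pairs n)))"
proof -
  obtain \<gamma> where bound: "\<And>i. \<bar>\<gamma> i\<bar> \<le> 2 * M * real (card (pairs n))"
      and mono: "\<And>i j. i \<in> pairs n \<Longrightarrow> j \<in> pairs n \<Longrightarrow> \<alpha> i \<le> \<alpha> j \<Longrightarrow> \<gamma> i \<le> \<gamma> j"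
        "\<And>i j. i \<in> pairs n \<Longrightarrow> j \<in> pairs n \<Longrightarrow> \<beta> i \<le> \<beta> j \<Longrightarrow>
          \<alpha> i + \<beta> i - \<gamma> i \<le> \<alpha> j + \<beta> j - \<gamma> j"
    by (rule bounded_order_preserving_summands[where \<alpha> = \<alpha> and \<beta> = \<beta>,
          OF finite_pairs[of n] \<open>0 \<le> M\<close>]) (erule bounded, rule that)
  let ?\<gamma> = "zero_ext (pairs n) \<gamma>"
  have "?\<gamma> \<in> ultrametrics n"
    by (rule ultrametrics_order_preserving[OF \<alpha>]) (simp_all add: zero_ext_def mono)
  moreover have "(\<lambda>i. \<alpha> i + \<beta> i - ?\<gamma> i) \<in> ultrametrics n"
    by (rule ultrametrics_order_preserving[OF \<beta>])
      (simp_all add: zero_ext_def mono ultrametrics_eq_0[OF \<alpha>] ultrametrics_eq_0[OF \<beta>])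
  moreover have "\<bar>?\<gamma> i\<bar> \<le> 2 * M * real (card (pairs n))" for i
    using bound[of i] \<open>0 \<le> M\<close> by (simp add: zero_ext_def)
  ultimately show ?thesis
    by blast
qed

lemma closed_ultrametrics_sum:
  "closed {(\<lambda>i. \<delta> i + \<delta>' i) | \<delta> \<delta>'. \<delta> \<in> ultrametrics n \<and> \<delta>' \<in> ultrametrics n}"
proof (rule closed_sum_if_bounded_summands[OF closed_ultrametrics closed_ultrametrics],
    intro exI ballI impI)
  fix m :: "nat \<times> nat \<Rightarrow> real" and \<alpha> \<beta>
  assume \<alpha>: "\<alpha> \<in> ultrametrics n" and \<beta>: "\<beta> \<in> ultrametrics n" and m: "\<forall>i. \<bar>\<alpha> i + \<beta> i\<bar> \<le> m i"
  let ?M = "\<Sum>i\<in>pairs n. \<bar>m i\<bar>"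
  have "\<bar>\<alpha> i + \<beta> i\<bar> \<le> ?M" if "i \<in> pairs n" for i
    using m[rule_format, of i] member_le_sum[OF that, of "\<lambda>i. \<bar>m i\<bar>"] finite_pairs[of n] by simp
  then show "\<exists>\<gamma>\<in>ultrametrics n. (\<lambda>i. \<alpha> i + \<beta> i - \<gamma> i) \<in> ultrametrics n \<and>
      (\<forall>i. \<bar>\<gamma> i\<bar> \<le> 2 * ?M * real (card (pairs n)))"
    by (intro bounded_ultrametrics_summands[OF \<alpha> \<beta>]) (simp_all add: sum_nonneg)
qed

section \<open>Tropical points\<close>

definition fls_torus_points ::
    "(nat \<times> nat) set \<Rightarrow> (nat \<times> nat \<Rightarrow> complex) set \<Rightarrow> (nat \<times> nat \<Rightarrow> complex fls) set" where
  "fls_torus_points S X =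
    {y. (\<forall>i\<in>S. y i \<noteq> 0) \<and> (\<forall>p\<in>vanishing_ideal S X. mpeval fls_const p y = 0)}"

definition val_vector :: "'i set \<Rightarrow> nat \<Rightarrow> ('i \<Rightarrow> 'a::zero fls) \<Rightarrow> 'i \<Rightarrow> real" where
  "val_vector S N y = zero_ext S (\<lambda>i. - real_of_int (fls_subdegree (y i)) / real N)"

lemma trop_eq_closure_val_vectors:
  "trop S X = closure {val_vector S N y | N y. 0 < N \<and> y \<in> fls_torus_points S X}"
  unfolding trop_def val_vector_def fls_torus_points_def zero_ext_def
  by (rule arg_cong[of _ _ closure]) blast

lemma fls_torus_points_CM_2_isotropic_coordinates:
  assumes "2 \<le> n" and y: "y \<in> fls_torus_points (pairs n) (CM n 2)"
  obtains a b where "\<And>u v. u \<in> {1..n} \<Longrightarrow> v \<in> {1..n} \<Longrightarrow>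
    fls_compose_power (sym_matrix y u v) 2 = isotropic_sqdist a b u v"
proof -
  interpret subst: comm_ring_hom "\<lambda>f :: complex fls. fls_compose_power f 2"
    by (rule comm_ring_hom_fls_compose_power) simp
  define D where "D u v = fls_compose_power (sym_matrix y u v) 2" for u v
  have nonzero: "D 1 2 \<noteq> 0"
    using y min_max_in_pairs[of 1 n 2] \<open>2 \<le> n\<close>
    by (auto simp: D_def fls_compose_power_eq_0_iff sym_matrix_def fls_torus_points_def)
  have diag: "D u u = 0" for u
    by (simp add: D_def sym_matrix_def)
  have relation: "rank_relation D 1 2 u v w = 0" if "u \<in> {1..n}" "v \<in> {1..n}" "w \<in> {1..n}" for u v w
  proof -
    have "rank_relation (sym_matrix var_mpoly) 1 2 u v w \<in> vanishing_ideal (pairs n) (CM n 2)"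
      using that \<open>2 \<le> n\<close> by (intro rank_relation_in_vanishing_ideal_CM_2) auto
    then have "rank_relation (sym_matrix y) 1 2 u v w = 0"
      using y by (auto simp: fls_torus_points_def simp flip: fls_const_hom.mpeval_rank_relation_var)
    then show ?thesis
      unfolding D_def by (simp flip: subst.hom_rank_relation)
  qed
  have root: "\<exists>r. r\<^sup>2 = gram_minor D 1 2 w w" for w
    unfolding D_def subst.hom_gram_minor[symmetric]
    by (rule fls_square_root_exists) (simp add: fls_subdegree_compose_power)
  show ?thesis
    using isotropic_coordinates_of_rank_relation[where D = D, OF nonzero diag relation root] that
    unfolding D_def by blast
qed

lemma fls_torus_points_CM_2_subdegree:
  assumes "2 \<le> n" and y: "y \<in> fls_torus_points (pairs n) (CM n 2)"
  obtains a b :: "nat \<Rightarrow> complex fls" where "inj_on a {1..n}" "inj_on b {1..n}"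
    "\<And>u v. (u, v) \<in> pairs n \<Longrightarrow>
      2 * fls_subdegree (y (u, v)) = fls_subdegree (a u - a v) + fls_subdegree (b u - b v)"
proof -
  obtain a b where ab: "\<And>u v. u \<in> {1..n} \<Longrightarrow> v \<in> {1..n} \<Longrightarrow>
      fls_compose_power (sym_matrix y u v) 2 = (a u - a v) * (b u - b v)"
    using fls_torus_points_CM_2_isotropic_coordinates[OF assms]
    unfolding isotropic_sqdist_def by blast
  have nonzero: "fls_compose_power (sym_matrix y u v) 2 \<noteq> 0"
    if "u \<in> {1..n}" "v \<in> {1..n}" "u \<noteq> v" for u v
    using y that min_max_in_pairs[OF that]
    by (simp add: fls_torus_points_def sym_matrix_def fls_compose_power_eq_0_iff)
  show ?thesis
  proof (rule that)
    show "inj_on a {1..n}" "inj_on b {1..n}"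
      by (intro inj_onI; use nonzero ab in fastforce)+
    fix u v assume "(u, v) \<in> pairs n"
    then have uv: "u \<in> {1..n}" "v \<in> {1..n}" "u < v"
      by (auto simp: pairs_def)
    then have "2 * fls_subdegree (y (u, v)) = fls_subdegree ((a u - a v) * (b u - b v))"
      using fls_subdegree_compose_power[of "sym_matrix y u v" 2]
      by (simp add: sym_matrix_def min_def max_def flip: ab)
    also have "\<dots> = fls_subdegree (a u - a v) + fls_subdegree (b u - b v)"
      using nonzero[of u v] ab[of u v] uv by simp
    finally show "2 * fls_subdegree (y (u, v)) =
        fls_subdegree (a u - a v) + fls_subdegree (b u - b v)" .
  qed
qed

lemma val_vector_eq_ultrametrics_sum:
  assumes "2 \<le> n" "0 < N" "y \<in> fls_torus_points (pairs n) (CM n 2)"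
  obtains \<delta> \<delta>' where "\<delta> \<in> ultrametrics n" "\<delta>' \<in> ultrametrics n"
    "val_vector (pairs n) N y = (\<lambda>i. \<delta> i + \<delta>' i)"
proof -
  obtain a b :: "nat \<Rightarrow> complex fls" where inj: "inj_on a {1..n}" "inj_on b {1..n}"
    and deg: "\<And>u v. (u, v) \<in> pairs n \<Longrightarrow>
      2 * fls_subdegree (y (u, v)) = fls_subdegree (a u - a v) + fls_subdegree (b u - b v)"
    by (rule fls_torus_points_CM_2_subdegree[OF assms(1,3)]) (rule that)
  define d where "d c = (\<lambda>u v. real_of_int (- fls_subdegree (c u - c v)) / real (2 * N))"
    for c :: "nat \<Rightarrow> complex fls"
  have mono: "mono (\<lambda>k. real_of_int k / real (2 * N))"
    by (intro monoI divide_right_mono) auto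
  have ultra: "zero_ext (pairs n) (case_prod (d c)) \<in> ultrametrics n" if "inj_on c {1..n}" for c
    unfolding d_def
    using ultrametric_on_compose_mono[OF ultrametric_on_fls_subdegree_diff[OF that] mono]
    by (rule zero_ext_in_ultrametrics)
  have "- real_of_int (fls_subdegree (y (u, v))) / real N = d a u v + d b u v"
    if "(u, v) \<in> pairs n" for u v
    using deg[OF that] \<open>0 < N\<close> by (simp add: d_def field_simps flip: of_int_add)
  then have "val_vector (pairs n) N y =
      (\<lambda>i. zero_ext (pairs n) (case_prod (d a)) i + zero_ext (pairs n) (case_prod (d b)) i)"
    by (auto simp: fun_eq_iff val_vector_def zero_ext_def)
  then show ?thesis
    using that ultra inj by blast
qed

lemma rational_ultrametrics_sum_in_trop:
  fixes d d' :: "nat \<Rightarrow> nat \<Rightarrow> int"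
  assumes "ultrametric_on {1..n} d" "ultrametric_on {1..n} d'" "0 < N"
  shows "zero_ext (pairs n) (\<lambda>(u, v). real_of_int (d u v + d' u v) / real N)
    \<in> trop (pairs n) (CM n 2)"
proof -
  obtain a :: "nat \<Rightarrow> complex fls" where a: "inj_on a {1..n}"
      "\<And>u v. u \<in> {1..n} \<Longrightarrow> v \<in> {1..n} \<Longrightarrow> u \<noteq> v \<Longrightarrow> - fls_subdegree (a u - a v) = d u v"
    using exists_fls_subdegree_diff_eq_ultrametric[OF finite_atLeastAtMost assms(1)] by blast
  obtain b :: "nat \<Rightarrow> complex fls" where b: "inj_on b {1..n}"
      "\<And>u v. u \<in> {1..n} \<Longrightarrow> v \<in> {1..n} \<Longrightarrow> u \<noteq> v \<Longrightarrow> - fls_subdegree (b u - b v) = d' u v"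
    using exists_fls_subdegree_diff_eq_ultrametric[OF finite_atLeastAtMost assms(2)] by blast
  let ?y = "case_prod (isotropic_sqdist a b)"
  have nonzero: "a u - a v \<noteq> 0" "b u - b v \<noteq> 0" if "(u, v) \<in> pairs n" for u v
    using that inj_onD[OF a(1), of u v] inj_onD[OF b(1), of u v] by (auto simp: pairs_def)
  have "?y \<in> fls_torus_points (pairs n) (CM n 2)"
    using nonzero
    by (auto simp: fls_torus_points_def isotropic_sqdist_def
        vanishing_ideal_CM_2_isotropic[OF fls_const_hom.coeff_hom_axioms])
  moreover have "val_vector (pairs n) N ?y =
      zero_ext (pairs n) (\<lambda>(u, v). real_of_int (d u v + d' u v) / real N)"
  proof -
    have "- fls_subdegree (?y (u, v)) = d u v + d' u v" if "(u, v) \<in> pairs n" for u v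
      using that a(2)[of u v] b(2)[of u v] nonzero[OF that]
      by (auto simp: isotropic_sqdist_def pairs_def)
    then show ?thesis
      by (auto simp: fun_eq_iff val_vector_def zero_ext_def simp del: case_prod_conv
          simp flip: of_int_minus)
  qed
  ultimately show ?thesis
    unfolding trop_eq_closure_val_vectors using \<open>0 < N\<close>
    by (intro closure_subset[THEN subsetD]) (auto intro!: exI)
qed

lemma LIMSEQ_floor_mult_divide: "(\<lambda>k. of_int \<lfloor>real (Suc k) * t\<rfloor> / real (Suc k)) \<longlonglongrightarrow> t"
proof (rule LIM_zero_cancel,
    rule Lim_null_comparison[OF always_eventually LIMSEQ_inverse_real_of_nat], rule allI)
  fix k
  define r where "r = real (Suc k)"
  have "r > 0"
    by (simp add: r_def)
  have "r * t - 1 \<le> of_int \<lfloor>r * t\<rfloor>" "of_int \<lfloor>r * t\<rfloor> \<le> r * t"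
    by linarith+
  then have "t - 1 / r \<le> of_int \<lfloor>r * t\<rfloor> / r" "of_int \<lfloor>r * t\<rfloor> / r \<le> t"
    using \<open>r > 0\<close>
    by (simp_all add: pos_le_divide_eq pos_divide_le_eq right_diff_distrib mult.commute)
  then have "\<bar>of_int \<lfloor>r * t\<rfloor> / r - t\<bar> \<le> 1 / r"
    by linarith
  then show "norm (of_int \<lfloor>real (Suc k) * t\<rfloor> / real (Suc k) - t) \<le> inverse (real (Suc k))"
    by (simp add: r_def inverse_eq_divide)
qed

lemma ultrametrics_sum_in_trop:
  assumes \<delta>: "\<delta> \<in> ultrametrics n" "\<delta>' \<in> ultrametrics n"
  shows "(\<lambda>i. \<delta> i + \<delta>' i) \<in> trop (pairs n) (CM n 2)"
proof -
  define d where "d \<epsilon> k = (\<lambda>u v. \<lfloor>real (Suc k) * dist_pair \<epsilon> u v\<rfloor>)" for \<epsilon> k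
  define x where "x k = zero_ext (pairs n)
    (\<lambda>(u, v). real_of_int (d \<delta> k u v + d \<delta>' k u v) / real (Suc k))" for k
  have mono: "mono (\<lambda>t. \<lfloor>real (Suc k) * t\<rfloor>)" for k
    by (intro monoI floor_mono mult_left_mono) auto
  have "ultrametric_on {1..n} (d \<epsilon> k)" if "\<epsilon> \<in> ultrametrics n" for \<epsilon> k
    unfolding d_def by (rule ultrametric_on_compose_mono[OF ultrametric_on_dist_pair[OF that] mono])
  then have "x k \<in> trop (pairs n) (CM n 2)" for k
    unfolding x_def using \<delta> by (intro rational_ultrametrics_sum_in_trop) auto
  moreover have "x \<longlonglongrightarrow> (\<lambda>i. \<delta> i + \<delta>' i)"
    unfolding tendsto_fun_iff
  proof
    fix i
    show "(\<lambda>k. x k i) \<longlonglongrightarrow> \<delta> i + \<delta>' i"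
    proof (cases "i \<in> pairs n")
      case True
      then have "x k i = of_int \<lfloor>real (Suc k) * \<delta> i\<rfloor> / real (Suc k) +
          of_int \<lfloor>real (Suc k) * \<delta>' i\<rfloor> / real (Suc k)" for k
        by (auto simp: x_def zero_ext_def d_def dist_pair_def pairs_def add_divide_distrib
            simp del: of_nat_Suc)
      then show ?thesis
        by (simp only: tendsto_add[OF LIMSEQ_floor_mult_divide LIMSEQ_floor_mult_divide])
    next
      case False
      then show ?thesis
        using \<delta> by (simp add: x_def zero_ext_def ultrametrics_eq_0)
    qed
  qed
  ultimately show ?thesis
    by (rule closed_sequentially[rotated]) (simp add: trop_eq_closure_val_vectors)
qed

theorem theorem3p1:
  fixes n :: nat
  assumes "n \<ge> 2"
  shows "trop (pairs n) (CM n 2) =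
         {(\<lambda>i. \<delta> i + \<delta>' i) | \<delta> \<delta>'. \<delta> \<in> ultrametrics n \<and> \<delta>' \<in> ultrametrics n}"
proof
  show "trop (pairs n) (CM n 2) \<subseteq>
      {(\<lambda>i. \<delta> i + \<delta>' i) | \<delta> \<delta>'. \<delta> \<in> ultrametrics n \<and> \<delta>' \<in> ultrametrics n}"
    unfolding trop_eq_closure_val_vectors
    by (rule closure_minimal[OF _ closed_ultrametrics_sum])
      (blast elim: val_vector_eq_ultrametrics_sum[OF assms])
  show "{(\<lambda>i. \<delta> i + \<delta>' i) | \<delta> \<delta>'. \<delta> \<in> ultrametrics n \<and> \<delta>' \<in> ultrametrics n}
      \<subseteq> trop (pairs n) (CM n 2)"
    using ultrametrics_sum_in_trop by blast
qed

end
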